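(* For any $0\le\vartheta_1<\vartheta_2$, let $\mathbb{X}_i=(\mathcal{X},\tilde{[\![\mathcal{T}]\!]}_i,x_0,\Pi,L)$, $i=1,2$, be the Markov systems (with modified transition probabilities) driven by $X_{t+1}=f(X_t)+b(X_t)w_t+\vartheta_i\xi_t$, where $\mathbb{X}_1$ is perturbed by point masses with intensity $\vartheta_1$ and $\mathbb{X}_2$ is perturbed by general $\mathcal{L}_1$-perturbations with intensity $\vartheta_2$. Assume that the labelling function $L$ is amenable to a rectangular partition. Then there exist a rectangular partition $Q$ (that is, a state-level relation $\alpha\subseteq\mathcal{X}\times Q$), a measure-level relation $\gamma_\alpha$, and a collection of transition matrices $[\![\Theta]\!]$ such that the finite-state Markov system $\mathbb{I}=(Q,[\![\Theta]\!],q_0,\Pi,L_{\mathbb{I}})$ abstracts $\mathbb{X}_1$ and is abstracted by $\mathbb{X}_2$ through $$\mathbb{X}_1\preceq_{\gamma_\alpha}\mathbb{I},\qquad \mathbb{I}\preceq_{\gamma_\alpha^{-1}}\mathbb{X}_2 .$$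
   Context: Systems. The state space is $\mathcal{X}=\mathcal{W}\cup\Delta\subseteq\mathbb{R}^n$, where $\mathcal{W}$ is a bounded working space and $\Delta=\mathcal{W}^c$ is the set of out-of-domain states. The systems are driven by $$X_{t+1}=f(X_t)+b(X_t)w_t+\vartheta\xi_t,$$ where $f:\mathbb{R}^n\to\mathbb{R}^n$ and $b:\mathbb{R}^n\to\mathbb{R}^{n\times k}$ are locally Lipschitz, $\{w_t\}$ are i.i.d. zero-mean Gaussian with covariance $I_{k\times k}$, and $\vartheta\ge0$ is the intensity of the perturbation. General $\mathcal{L}_1$-perturbation: the memoryless perturbations $\xi_t$ are independent $\mathbb{R}^n$-valued random variables with $\mathcal{E}|\xi_t|\le1$ ($|\cdot|$ the infinity norm) and otherwise unknown distributions; no other condition is imposed. Point-mass perturbation: $\xi_t$ has a Dirac distribution $\delta_\xi$ at an uncertain point $\xi\in\mathbb{B}=\{x\in\mathbb{R}^n:|x|\le1\}$. Processes are stopped on leaving $\mathcal{W}$. $[\![\mathcal{T}]\!]_i$ is the collection of one-step transition probabilities of the $i$-th system (at each time the transition is chosen from this collection). For $x\in\mathcal{W}$, in the point-mass case $\mathcal{T}(x,\cdot)$ ranges over $\{\mathcal{N}(f(x)+\vartheta\xi,\;b(x)b^T(x)):\xi\in\mathbb{B}\}$; in the $\mathcal{L}_1$ case it ranges over the laws of $f(x)+b(x)w+\vartheta\xi$ with $w$ standard Gaussian and $\mathcal{E}|\xi|\le1$. For $x\notin\mathcal{W}$, $\mathcal{T}(x,\mathcal{W})=0$. Modified transitions: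 for $\mathcal{T}_i\in[\![\mathcal{T}]\!]_i$, $\tilde{\mathcal{T}}_i$ is given by $\tilde{\mathcal{T}}_i(x,\Gamma)=\mathcal{T}_i(x,\Gamma)$ for $\Gamma\subseteq\mathcal{W}$, $x\in\mathcal{W}$; $\tilde{\mathcal{T}}_i(x,\partial\mathcal{W})=\mathcal{T}_i(x,\mathcal{W}^c)$ for $x\in\mathcal{W}$; and $\tilde{\mathcal{T}}_i(x,\partial\mathcal{W})=1$ for $x\in\partial\mathcal{W}$. (The out-of-domain mass is represented by a weighted point mass at the boundary, in such a way that the mean remains the same; the law of the stopped process inside $\mathcal{W}$ is unaffected.) $\tilde{[\![\mathcal{T}]\!]}_i$ is the collection of all $\tilde{\mathcal{T}}_i$. $\Pi$ is a finite set of atomic propositions; $L:\mathcal{X}\to2^\Pi$ is a Borel-measurable labelling function with $\textbf{in}\in L(x)$ for $x\notin\Delta$ and $\textbf{in}\notin L(\Delta)$, where $\textbf{in}\in\Pi$. "Amenable to a rectangular partition" means that a state-level abstraction can be obtained from a rectangular partition, i.e. a finite partition of $\mathcal{W}$ into axis-aligned boxes, together with the single element $\Delta$, on each element of which $L$ is constant. $x_0$ is the initial condition and $q_0\in Q$ the corresponding discrete initial state, $(x_0,q_0)\in\alpha$. Relations. For a relation $\gamma\subseteq A\times B$ and $b\in B$, $\gamma^{-1}(b)=\{a:(a,b)\in\gamma\}$; $\gamma^{-1}$ also denotes the converse relation. $\mathfrak{P}(\cdot)$ denotes the set of probability measures on a space. Abstraction. Let $\mathbb{X}=(\mathcal{X},[\![\mathcal{T}]\!],\Pi,L)$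 be a continuous-state Markov system and $\mathbb{I}=(Q,[\![\Theta]\!],\Pi,L_{\mathbb{I}})$ a finite-state Markov system, with $Q=(q_1,\dots,q_m)^T$ and $[\![\Theta]\!]$ a collection of $m\times m$ stochastic matrices ($\Theta_i$ is the $i$-th row of $\Theta$). A state-level abstraction is a relation $\alpha\subseteq\mathcal{X}\times Q$ such that every $x\in\mathcal{X}$ is related to some $q\in Q$ and $L_{\mathbb{I}}(q)=L(x)$ for all $(x,q)\in\alpha$. A relation $\gamma\subseteq\mathfrak{P}(\mathcal{X})\times\mathfrak{P}(Q)$ is a measure-level abstraction from $\mathbb{X}$ to $\mathbb{I}$ if for all $i$, all $\mathcal{T}\in[\![\mathcal{T}]\!]$ and all $x\in\alpha^{-1}(q_i)$ there exists $\Theta\in[\![\Theta]\!]$ with $(\mathcal{T}(x,\cdot),\Theta_i)\in\gamma$ and $\mathcal{T}(x,\alpha^{-1}(q_j))=\Theta_{ij}$ for all $j$. A relation $\gamma\subseteq\mathfrak{P}(Q)\times\mathfrak{P}(\mathcal{X})$ is a measure-level abstraction from $\mathbb{I}$ to $\mathbb{X}$ if for all $i$, all $\Theta\in[\![\Theta]\!]$ and all $x\in\alpha^{-1}(q_i)$ there exists $\mathcal{T}\in[\![\mathcal{T}]\!]$ with $(\Theta_i,\mathcal{T}(x,\cdot))\in\gamma$ and $\mathcal{T}(x,\alpha^{-1}(q_j))=\Theta_{ij}$ for all $j$. If such $\alpha$ and $\gamma$ exist, we say $\mathbb{I}$ abstracts $\mathbb{X}$, written $\mathbb{X}\preceq_\gamma\mathbb{I}$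 (respectively $\mathbb{X}$ abstracts $\mathbb{I}$, written $\mathbb{I}\preceq_\gamma\mathbb{X}$). *)

theory Defs
  imports "HOL-Probability.Probability"
begin

section \<open>Finite partitions into axis-aligned boxes\<close>

text \<open>The factors are arbitrary (open, closed, half-open) intervals, so that also an
  open working space can be partitioned into finitely many pairwise disjoint boxes.\<close>

definition axis_box :: "(real ^ 'n) set \<Rightarrow> bool" where
  "axis_box R \<longleftrightarrow> (\<exists>J :: 'n \<Rightarrow> real set. (\<forall>i. is_interval (J i)) \<and> R = {x. \<forall>i. x $ i \<in> J i})"

definition rectangular_partition :: "(real ^ 'n) set \<Rightarrow> (real ^ 'n) set set \<Rightarrow> bool" where
  "rectangular_partition W P \<longleftrightarrow> finite P \<and> partition_on W P \<and> (\<forall>R\<in>P. axis_box R)"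

text \<open>The set \<open>- W\<close> of out-of-domain states is one further cell.\<close>

definition amenable_to_rectangular_partition ::
    "(real ^ 'n) set \<Rightarrow> (real ^ 'n \<Rightarrow> 'p set) \<Rightarrow> bool" where
  "amenable_to_rectangular_partition W L \<longleftrightarrow>
     (\<exists>P. rectangular_partition W P \<and> (\<forall>R\<in>insert (- W) P. L constant_on R))"

definition labelling ::
    "(real ^ 'n) set \<Rightarrow> 'p set \<Rightarrow> 'p \<Rightarrow> (real ^ 'n \<Rightarrow> 'p set) \<Rightarrow> bool" where
  "labelling W AP inn L \<longleftrightarrow>
     finite AP \<and> inn \<in> AP \<and>
     L \<in> borel \<rightarrow>\<^sub>M count_space (Pow AP) \<and>
     (\<forall>x\<in>W. inn \<in> L x) \<and> (\<forall>x. x \<notin> W \<longrightarrow> inn \<notin> L x)"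


section \<open>One-step transition probabilities\<close>

definition locally_lipschitz :: "('a::metric_space \<Rightarrow> 'b::metric_space) \<Rightarrow> bool" where
  "locally_lipschitz g \<longleftrightarrow> (\<forall>x. \<exists>u>0. \<exists>C. C-lipschitz_on (ball x u) g)"

text \<open>The law of \<open>k\<close> independent standard normal coordinates, i.e. \<open>N(0, I)\<close> on \<open>\<real>\<^sup>k\<close>.\<close>

definition std_gaussian :: "(real ^ 'k) measure" where
  "std_gaussian = distr (\<Pi>\<^sub>M i\<in>(UNIV :: 'k set). density lborel std_normal_density) borel
     (\<lambda>g. \<chi> i. g i)"

text \<open>\<open>gaussian m B\<close> is \<open>N(m, B B\<^sup>T)\<close>; the covariance may be singular, hence no density.\<close>

definition gaussian :: "real ^ 'n \<Rightarrow> real ^ 'k ^ 'n \<Rightarrow> (real ^ 'n) measure" where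
  "gaussian m B = distr std_gaussian borel (\<lambda>w. m + B *v w)"

definition point_mass_laws ::
    "(real ^ 'n \<Rightarrow> real ^ 'n) \<Rightarrow> (real ^ 'n \<Rightarrow> real ^ 'k ^ 'n) \<Rightarrow> real \<Rightarrow> real ^ 'n \<Rightarrow>
     (real ^ 'n) measure set" where
  "point_mass_laws f b \<theta> x = {gaussian (f x + \<theta> *\<^sub>R \<xi>) (b x) |\<xi>. infnorm \<xi> \<le> 1}"

text \<open>\<open>M\<close> is the joint law of \<open>(w, \<xi>)\<close>. Apart from the moment bound nothing is imposed on
  \<open>\<xi>\<close>; in particular \<open>\<xi>\<close> need not be independent of \<open>w\<close>.\<close>

definition L1_laws ::
    "(real ^ 'n \<Rightarrow> real ^ 'n) \<Rightarrow> (real ^ 'n \<Rightarrow> real ^ 'k ^ 'n) \<Rightarrow> real \<Rightarrow> real ^ 'n \<Rightarrow>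
     (real ^ 'n) measure set" where
  "L1_laws f b \<theta> x =
     {distr M borel (\<lambda>(w, \<xi>). f x + b x *v w + \<theta> *\<^sub>R \<xi>) |M :: ((real ^ 'k) \<times> (real ^ 'n)) measure.
        M \<in> space (prob_algebra borel) \<and> distr M borel fst = std_gaussian \<and>
        (\<integral>\<^sup>+ z. ennreal (infnorm (snd z)) \<partial>M) \<le> 1}"

text \<open>The Markov kernels whose law at each state of \<open>W\<close> is one of the given laws.\<close>

definition transition_collection ::
    "(real ^ 'n) set \<Rightarrow> (real ^ 'n \<Rightarrow> (real ^ 'n) measure set) \<Rightarrow>
     (real ^ 'n \<Rightarrow> (real ^ 'n) measure) set" where
  "transition_collection W laws =
     {T. T \<in> borel \<rightarrow>\<^sub>M prob_algebra borel \<and>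
         (\<forall>x\<in>W. T x \<in> laws x) \<and> (\<forall>x. x \<notin> W \<longrightarrow> measure (T x) W = 0)}"

text \<open>\<open>T'\<close> is the modification of \<open>T\<close> in which the mass leaving \<open>W\<close> is moved to the boundary.
  The equations are contradictory in general when \<open>W\<close> meets its frontier, so they are meant for
  a working space without its boundary. The last clause retains \<open>T(x, W) = 0\<close> off \<open>W\<close>. Where on
  the boundary the mass is put is left open here, see \<open>modified_collection\<close>.\<close>

definition modified_transition ::
    "(real ^ 'n) set \<Rightarrow> (real ^ 'n \<Rightarrow> (real ^ 'n) measure) \<Rightarrow>
     (real ^ 'n \<Rightarrow> (real ^ 'n) measure) \<Rightarrow> bool" where
  "modified_transition W T T' \<longleftrightarrow>
     T' \<in> borel \<rightarrow>\<^sub>M prob_algebra borel \<and>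
     (\<forall>x\<in>W. \<forall>\<Gamma>\<in>sets borel. \<Gamma> \<subseteq> W \<longrightarrow> measure (T' x) \<Gamma> = measure (T x) \<Gamma>) \<and>
     (\<forall>x\<in>W. measure (T' x) (frontier W) = measure (T x) (- W)) \<and>
     (\<forall>x\<in>frontier W. measure (T' x) (frontier W) = 1) \<and>
     (\<forall>x. x \<notin> W \<longrightarrow> measure (T' x) W = 0)"

text \<open>\<open>TT'\<close> consists of modifications of members of \<open>TT\<close>, at least one for each member. The
  placement of the mass on the boundary may be any one, or several, for each member; a
  mean-preserving placement is an instance whenever there is one (in general there is none, e.g.
  if \<open>f\<close> maps a state far away from \<open>W\<close>).\<close>

definition modified_collection ::
    "(real ^ 'n) set \<Rightarrow> (real ^ 'n \<Rightarrow> (real ^ 'n) measure) set \<Rightarrow>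
     (real ^ 'n \<Rightarrow> (real ^ 'n) measure) set \<Rightarrow> bool" where
  "modified_collection W TT TT' \<longleftrightarrow> rel_set (modified_transition W) TT TT'"


section \<open>Markov systems and abstractions\<close>

text \<open>The state space of a continuous-state system is the whole type, since it is \<open>W \<union> - W\<close>.\<close>

record ('s, 'p) markov_system =
  transitions :: "('s \<Rightarrow> 's measure) set"
  initial :: 's
  props :: "'p set"
  label :: "'s \<Rightarrow> 'p set"

text \<open>Matrices are indexed by the states themselves instead of by \<open>1, \<dots>, m\<close>.\<close>

record ('q, 'p) finite_system =
  states :: "'q set"
  matrices :: "('q \<Rightarrow> 'q \<Rightarrow> real) set"
  f_initial :: 'q
  f_props :: "'p set"
  f_label :: "'q \<Rightarrow> 'p set"

definition stochastic_matrix :: "'q set \<Rightarrow> ('q \<Rightarrow> 'q \<Rightarrow> real) \<Rightarrow> bool" where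
  "stochastic_matrix Q \<Theta> \<longleftrightarrow> (\<forall>q\<in>Q. (\<forall>r\<in>Q. 0 \<le> \<Theta> q r) \<and> (\<Sum>r\<in>Q. \<Theta> q r) = 1)"

definition finite_markov_system :: "('q, 'p) finite_system \<Rightarrow> bool" where
  "finite_markov_system I \<longleftrightarrow>
     finite (states I) \<and> f_initial I \<in> states I \<and>
     finite (f_props I) \<and> (\<forall>q\<in>states I. f_label I q \<subseteq> f_props I) \<and>
     (\<forall>\<Theta>\<in>matrices I. stochastic_matrix (states I) \<Theta>)"

definition row_measure :: "'q set \<Rightarrow> ('q \<Rightarrow> 'q \<Rightarrow> real) \<Rightarrow> 'q \<Rightarrow> 'q measure" where
  "row_measure Q \<Theta> q = point_measure Q (\<lambda>r. ennreal (\<Theta> q r))"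

definition state_level_abstraction ::
    "('s \<times> 'q) set \<Rightarrow> ('s, 'p) markov_system \<Rightarrow> ('q, 'p) finite_system \<Rightarrow> bool" where
  "state_level_abstraction \<alpha> X I \<longleftrightarrow>
     \<alpha> \<subseteq> UNIV \<times> states I \<and> (\<forall>x. \<exists>q. (x, q) \<in> \<alpha>) \<and>
     (\<forall>(x, q)\<in>\<alpha>. f_label I q = label X x)"

definition measure_level_abstraction_to ::
    "('s \<times> 'q) set \<Rightarrow> ('s::topological_space measure \<times> 'q measure) set \<Rightarrow>
     ('s, 'p) markov_system \<Rightarrow> ('q, 'p) finite_system \<Rightarrow> bool" where
  "measure_level_abstraction_to \<alpha> \<gamma> X I \<longleftrightarrow>
     \<gamma> \<subseteq> space (prob_algebra borel) \<times> space (prob_algebra (count_space (states I))) \<and>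
     (\<forall>q\<in>states I. \<forall>T\<in>transitions X. \<forall>x\<in>\<alpha>\<inverse> `` {q}. \<exists>\<Theta>\<in>matrices I.
        (T x, row_measure (states I) \<Theta> q) \<in> \<gamma> \<and>
        (\<forall>r\<in>states I. measure (T x) (\<alpha>\<inverse> `` {r}) = \<Theta> q r))"

definition measure_level_abstraction_from ::
    "('s \<times> 'q) set \<Rightarrow> ('q measure \<times> 's::topological_space measure) set \<Rightarrow>
     ('q, 'p) finite_system \<Rightarrow> ('s, 'p) markov_system \<Rightarrow> bool" where
  "measure_level_abstraction_from \<alpha> \<gamma> I X \<longleftrightarrow>
     \<gamma> \<subseteq> space (prob_algebra (count_space (states I))) \<times> space (prob_algebra borel) \<and>
     (\<forall>q\<in>states I. \<forall>\<Theta>\<in>matrices I. \<forall>x\<in>\<alpha>\<inverse> `` {q}. \<exists>T\<in>transitions X.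
        (row_measure (states I) \<Theta> q, T x) \<in> \<gamma> \<and>
        (\<forall>r\<in>states I. measure (T x) (\<alpha>\<inverse> `` {r}) = \<Theta> q r))"

text \<open>\<open>finite_abstracts \<alpha> \<gamma> X I\<close> is \<open>X \<preceq>\<^sub>\<gamma> I\<close>, and \<open>continuous_abstracts \<alpha> \<gamma> I X\<close> is
  \<open>I \<preceq>\<^sub>\<gamma> X\<close>, both with the state-level relation made explicit.\<close>

definition finite_abstracts ::
    "('s \<times> 'q) set \<Rightarrow> ('s::topological_space measure \<times> 'q measure) set \<Rightarrow>
     ('s, 'p) markov_system \<Rightarrow> ('q, 'p) finite_system \<Rightarrow> bool" where
  "finite_abstracts \<alpha> \<gamma> X I \<longleftrightarrow>
     state_level_abstraction \<alpha> X I \<and> measure_level_abstraction_to \<alpha> \<gamma> X I"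

definition continuous_abstracts ::
    "('s \<times> 'q) set \<Rightarrow> ('q measure \<times> 's::topological_space measure) set \<Rightarrow>
     ('q, 'p) finite_system \<Rightarrow> ('s, 'p) markov_system \<Rightarrow> bool" where
  "continuous_abstracts \<alpha> \<gamma> I X \<longleftrightarrow>
     state_level_abstraction \<alpha> X I \<and> measure_level_abstraction_from \<alpha> \<gamma> I X"

text \<open>The cells of a partition of \<open>W\<close> together with the single cell \<open>- W\<close>, and membership
  of a state in a cell.\<close>

definition cells :: "'s set \<Rightarrow> 's set set \<Rightarrow> 's set set" where
  "cells W P = insert (- W) P"

definition cell_relation :: "'s set set \<Rightarrow> ('s \<times> 's set) set" where
  "cell_relation Q = {(x, q). q \<in> Q \<and> x \<in> q}"

end

theory Submission
  imports Defs
begin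

text \<open>The slack \<open>\<theta>\<^sub>2 - \<theta>\<^sub>1\<close> pays for the discretisation error, and an \<open>L\<^sub>1\<close>-perturbation can
  imitate that error exactly because it may depend on the Gaussian noise. Let \<open>x\<close> and \<open>y\<close> lie
  in one cell inside \<open>W\<close>, and let the first system move from \<open>y\<close> under the point mass \<open>\<xi>\<close> to
  \<open>f y + b y w + \<theta>\<^sub>1 \<xi>\<close>. With the same noise \<open>w\<close> this equals \<open>f x + b x w + \<theta>\<^sub>2 \<zeta>\<close> for
  \<open>\<zeta> = ((f y - f x) + (b y - b x) w + \<theta>\<^sub>1 \<xi>) / \<theta>\<^sub>2\<close>. Since \<open>f\<close> and \<open>b\<close> are uniformly continuous
  on the bounded set \<open>W\<close>, a rectangular partition fine enough makes both differences at most
  \<open>\<eta>\<close>, so that the mean of \<open>|\<zeta>|\<close> is at most \<open>(\<theta>\<^sub>1 + \<eta> (1 + E|w|)) / \<theta>\<^sub>2\<close>, and this is at most 1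
  for a small \<open>\<eta>\<close>. Hence every law of the first system at \<open>y\<close> is a law of the second system
  at \<open>x\<close> (\<open>point_mass_laws_subset_L1_laws\<close>), not merely one with similar cell probabilities.

  It follows that the finite system whose matrices have as rows exactly the vectors of cell
  probabilities of the first system, with the rows chosen independently of each other, works
  on both sides (\<open>finite_abstraction_of_cellwise_dominated\<close>). Moving the outgoing mass to the
  boundary is harmless: the cell \<open>- W\<close> always carries the complement of the mass in \<open>W\<close>, so that the
  cell probabilities depend only on the unmodified law
  (\<open>modified_transition_measure_cong\<close>).\<close>

section \<open>Rectangular partitions of small mesh\<close>

lemma axis_box_borel:
  fixes R :: "(real ^ 'n) set"
  assumes "axis_box R"
  shows "R \<in> sets borel"
proof -
  obtain J :: "'n \<Rightarrow> real set" where J: "\<And>i. is_interval (J i)" "R = {x. \<forall>i. x $ i \<in> J i}"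
    using assms by (auto simp: axis_box_def)
  have "{x :: real ^ 'n. x $ i \<in> J i} \<in> sets borel" for i
  proof -
    have [measurable]: "J i \<in> sets borel"
      using J(1)[of i] by (rule real_interval_borel_measurable)
    have [measurable]: "(\<lambda>x :: real ^ 'n. x $ i) \<in> borel_measurable borel"
      by (intro borel_measurable_continuous_onI continuous_intros)
    show ?thesis by measurable
  qed
  then have "(\<Inter>i. {x :: real ^ 'n. x $ i \<in> J i}) \<in> sets borel" by (intro sets.finite_INT) auto
  moreover have "R = (\<Inter>i. {x. x $ i \<in> J i})" using J by auto
  ultimately show ?thesis by simp
qed

lemma rectangular_partition_borel:
  assumes "rectangular_partition W P"
  shows "W \<in> sets borel"
  using assms axis_box_borel unfolding rectangular_partition_def partition_on_def
  by (metis sets.finite_Union subsetI)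

text \<open>Intersecting every box with the cubes of a grid keeps boxes boxes; boundedness of \<open>W\<close> leaves
  only finitely many cubes. A cube is the set of points with given coordinatewise floors after
  scaling, which makes disjointness immediate.\<close>

lemma rectangular_partition_refine:
  fixes W :: "(real ^ 'n) set"
  assumes P\<^sub>0: "rectangular_partition W P\<^sub>0" and "bounded W" and "0 < \<delta>"
  obtains P where "rectangular_partition W P"
    and "\<And>R. R \<in> P \<Longrightarrow> \<exists>R\<^sub>0\<in>P\<^sub>0. R \<subseteq> R\<^sub>0"
    and "\<And>R x y. R \<in> P \<Longrightarrow> x \<in> R \<Longrightarrow> y \<in> R \<Longrightarrow> dist x y < \<delta>"
proof -
  \<comment> \<open>The Euclidean distance is at most the sum of the coordinate distances, each below \<open>h\<close>.\<close>
  define h where "h = \<delta> / CARD('n)"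
  have "0 < h" using \<open>0 < \<delta>\<close> by (simp add: h_def)
  define G where "G k = {x :: real ^ 'n. \<forall>i. \<lfloor>x $ i / h\<rfloor> = k i}" for k :: "'n \<Rightarrow> int"
  obtain B where B: "\<And>x. x \<in> W \<Longrightarrow> norm x \<le> B"
    using \<open>bounded W\<close> by (auto simp: bounded_iff)
  define K where "K = (\<Pi>\<^sub>E i\<in>(UNIV :: 'n set). {\<lfloor>- B / h\<rfloor>..\<lfloor>B / h\<rfloor>})"
  have "finite K" unfolding K_def by (intro finite_PiE) auto
  have floor_in_K: "(\<lambda>i. \<lfloor>x $ i / h\<rfloor>) \<in> K" if "x \<in> W" for x
  proof -
    have "\<bar>x $ i\<bar> \<le> B" for i
      using B[OF that] component_le_norm_cart[of x i] by linarith
    then have "- B \<le> x $ i" "x $ i \<le> B" for i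
      by (auto simp: abs_le_iff minus_le_iff)
    then have "- B / h \<le> x $ i / h" "x $ i / h \<le> B / h" for i
      using \<open>0 < h\<close> divide_right_mono[of "- B" "x $ i" h] divide_right_mono[of "x $ i" B h] by auto
    then show ?thesis by (simp add: K_def PiE_UNIV_domain floor_mono)
  qed
  define P where "P = (\<lambda>(R, k). R \<inter> G k) ` (P\<^sub>0 \<times> K) - {{}}"
  have fin: "finite P\<^sub>0" and part: "partition_on W P\<^sub>0" and box: "\<And>R. R \<in> P\<^sub>0 \<Longrightarrow> axis_box R"
    using P\<^sub>0 by (auto simp: rectangular_partition_def)
  have "finite P" using fin \<open>finite K\<close> by (simp add: P_def)
  moreover have "partition_on W P"
  proof (rule partition_onI)
    show "\<Union> P = W"
    proof
      show "\<Union> P \<subseteq> W" using part by (auto simp: P_def partition_on_def)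
      show "W \<subseteq> \<Union> P"
      proof
        fix x assume "x \<in> W"
        then obtain R where "R \<in> P\<^sub>0" "x \<in> R" using part by (auto simp: partition_on_def)
        moreover have "x \<in> G (\<lambda>i. \<lfloor>x $ i / h\<rfloor>)" by (simp add: G_def)
        ultimately show "x \<in> \<Union> P" using floor_in_K[OF \<open>x \<in> W\<close>] unfolding P_def by blast
      qed
    qed
    show "{} \<notin> P" by (simp add: P_def)
    fix p q assume "p \<in> P" "q \<in> P" "p \<noteq> q"
    then obtain R k R' k' where
      *: "R \<in> P\<^sub>0" "p = R \<inter> G k" "R' \<in> P\<^sub>0" "q = R' \<inter> G k'" "R \<noteq> R' \<or> k \<noteq> k'"
      by (auto simp: P_def)
    have "G k \<inter> G k' = {}" if "k \<noteq> k'"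
      using that by (auto simp: G_def)
    moreover have "R \<inter> R' = {}" if "R \<noteq> R'"
      using that part * by (auto simp: partition_on_def disjoint_def)
    ultimately show "disjnt p q" using * by (auto simp: disjnt_def)
  qed
  moreover have "axis_box R" if "R \<in> P" for R
  proof -
    obtain R\<^sub>0 k where R: "R\<^sub>0 \<in> P\<^sub>0" "R = R\<^sub>0 \<inter> G k"
      using \<open>R \<in> P\<close> by (auto simp: P_def)
    obtain J where J: "\<And>i. is_interval (J i)" "R\<^sub>0 = {x. \<forall>i. x $ i \<in> J i}"
      using box[OF R(1)] by (auto simp: axis_box_def)
    have "is_interval {t :: real. \<lfloor>t / h\<rfloor> = c}" for c
      unfolding is_interval_1
    proof (intro ballI allI impI CollectI)
      fix a b x :: real assume "a \<in> {t. \<lfloor>t / h\<rfloor> = c}" "b \<in> {t. \<lfloor>t / h\<rfloor> = c}" "a \<le> x \<and> x \<le> b"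
      then have "\<lfloor>a / h\<rfloor> = c" "\<lfloor>b / h\<rfloor> = c" and le: "a / h \<le> x / h" "x / h \<le> b / h"
        using \<open>0 < h\<close> by (auto simp: divide_right_mono)
      then show "\<lfloor>x / h\<rfloor> = c" using floor_mono[OF le(1)] floor_mono[OF le(2)] by linarith
    qed
    then have "\<forall>i. is_interval (J i \<inter> {t. \<lfloor>t / h\<rfloor> = k i})"
      using J(1) by (auto intro: is_interval_Int)
    moreover have "R = {x. \<forall>i. x $ i \<in> J i \<inter> {t. \<lfloor>t / h\<rfloor> = k i}}"
      using J(2) R(2) by (auto simp: G_def)
    ultimately show ?thesis
      unfolding axis_box_def by (intro exI[of _ "\<lambda>i. J i \<inter> {t. \<lfloor>t / h\<rfloor> = k i}"]) auto
  qed
  ultimately have "rectangular_partition W P" by (simp add: rectangular_partition_def)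
  moreover have "\<exists>R\<^sub>0\<in>P\<^sub>0. R \<subseteq> R\<^sub>0" if "R \<in> P" for R using that by (auto simp: P_def)
  moreover have "dist x y < \<delta>" if R: "R \<in> P" "x \<in> R" "y \<in> R" for R x y
  proof -
    have comp: "\<bar>(x - y) $ i\<bar> < h" for i
    proof -
      have "\<lfloor>x $ i / h\<rfloor> = \<lfloor>y $ i / h\<rfloor>" using R by (auto simp: P_def G_def)
      then have "\<bar>x $ i / h - y $ i / h\<bar> < 1" by linarith
      then have "\<bar>(x $ i - y $ i) / h\<bar> < 1" by (simp add: diff_divide_distrib)
      then show ?thesis using \<open>0 < h\<close> by (simp add: abs_divide)
    qed
    have "norm (x - y) \<le> (\<Sum>i\<in>UNIV. \<bar>(x - y) $ i\<bar>)" by (rule norm_le_l1_cart)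
    also have "\<dots> < (\<Sum>i\<in>(UNIV :: 'n set). h)" by (intro sum_strict_mono comp) auto
    also have "\<dots> = \<delta>" by (simp add: h_def)
    finally show ?thesis by (simp add: dist_norm)
  qed
  ultimately show ?thesis using that by blast
qed


section \<open>The Gaussian noise and the coupling\<close>

lemma locally_lipschitz_continuous_on:
  assumes "locally_lipschitz g"
  shows "continuous_on UNIV g"
proof (intro continuous_at_imp_continuous_on ballI)
  fix x
  obtain u C where "0 < u" "C-lipschitz_on (ball x u) g"
    using assms unfolding locally_lipschitz_def by blast
  then have "continuous_on (ball x u) g" by (simp add: lipschitz_on_continuous_on)
  then show "isCont g x" using \<open>0 < u\<close> by (simp add: continuous_on_eq_continuous_at)
qed

lemma continuous_on_matrix_vector_mult [continuous_intros]:
  fixes A :: "'a::topological_space \<Rightarrow> real ^ 'k ^ 'n" and v :: "'a \<Rightarrow> real ^ 'k"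
  assumes "continuous_on S A" "continuous_on S v"
  shows "continuous_on S (\<lambda>z. A z *v v z)"
  unfolding matrix_vector_mult_def using assms by (intro continuous_intros)

lemma infnorm_matrix_vector_mult_le:
  fixes A :: "real ^ 'k ^ 'n"
  shows "infnorm (A *v v) \<le> norm A * norm v"
proof -
  have "\<bar>(A *v v) $ i\<bar> \<le> norm A * norm v" for i
  proof -
    have "\<bar>A $ i \<bullet> v\<bar> \<le> norm (A $ i) * norm v" by (rule Cauchy_Schwarz_ineq2)
    also have "\<dots> \<le> norm A * norm v" by (intro mult_right_mono Finite_Cartesian_Product.norm_nth_le) auto
    finally show ?thesis by (simp add: matrix_vector_mul_component)
  qed
  then show ?thesis unfolding infnorm_cart by (intro cSup_least) auto
qed

lemma vec_lambda_measurable_PiM: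
  "(\<lambda>g. \<chi> i. g i) \<in>
     (\<Pi>\<^sub>M i\<in>(UNIV :: 'k::finite set). density lborel std_normal_density) \<rightarrow>\<^sub>M (borel :: (real ^ 'k) measure)"
proof -
  have "(\<lambda>g. g i) \<in> borel_measurable (\<Pi>\<^sub>M i\<in>(UNIV :: 'k set). density lborel std_normal_density)" for i
    using measurable_component_singleton[of i UNIV "\<lambda>_ :: 'k. density lborel std_normal_density"]
    by (simp cong: measurable_cong_sets)
  then show ?thesis
    by (subst borel_measurable_euclidean_space) (auto simp: Basis_vec_def inner_axis)
qed

lemma std_gaussian_prob: "std_gaussian \<in> space (prob_algebra borel)"
proof -
  interpret prob_space "density lborel std_normal_density"
    by (rule prob_space_normal_density) simp
  interpret product_prob_space "\<lambda>_. density lborel std_normal_density" UNIV ..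
  show ?thesis
    unfolding std_gaussian_def space_prob_algebra
    using prob_space_distr[OF vec_lambda_measurable_PiM] by simp
qed

lemma sets_std_gaussian [simp, measurable_cong]: "sets std_gaussian = sets borel"
  by (simp add: std_gaussian_def)

lemma space_std_gaussian [simp]: "space std_gaussian = UNIV"
  by (simp add: std_gaussian_def)

text \<open>The first absolute moment of the noise is what an error proportional to \<open>w\<close> costs in the
  moment bound of the perturbation.\<close>

lemma nn_integral_norm_std_gaussian:
  "(\<integral>\<^sup>+ w. ennreal (norm w) \<partial>(std_gaussian :: (real ^ 'k) measure)) < \<infinity>"
proof -
  let ?N = "density lborel std_normal_density :: real measure"
  let ?M = "\<Pi>\<^sub>M i\<in>(UNIV :: 'k set). ?N"
  have N: "prob_space ?N" by (rule prob_space_normal_density) simp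
  have [measurable]: "(\<lambda>g. g i) \<in> ?M \<rightarrow>\<^sub>M ?N" for i
    by (rule measurable_component_singleton) simp
  have one: "(\<integral>\<^sup>+ g. ennreal \<bar>g i\<bar> \<partial>?M) < \<infinity>" for i :: 'k
  proof -
    have "(\<integral>\<^sup>+ g. ennreal \<bar>g i\<bar> \<partial>?M) = (\<integral>\<^sup>+ t. ennreal \<bar>t\<bar> \<partial>distr ?M ?N (\<lambda>g. g i))"
      by (subst nn_integral_distr) auto
    also have "\<dots> = (\<integral>\<^sup>+ t. ennreal \<bar>t\<bar> \<partial>?N)"
      using distr_PiM_component[of UNIV "\<lambda>_ :: 'k. ?N" i] N by simp
    also have "\<dots> = (\<integral>\<^sup>+ t. ennreal (std_normal_density t * \<bar>t\<bar> ^ 1) \<partial>lborel)"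
      by (subst nn_integral_density) (auto simp: ennreal_mult)
    also have "\<dots> < \<infinity>"
      using integrable_std_normal_moment_abs[of 1]
      by (subst nn_integral_eq_integral) auto
    finally show ?thesis .
  qed
  have "(\<integral>\<^sup>+ w. ennreal (norm w) \<partial>(std_gaussian :: (real ^ 'k) measure))
      = (\<integral>\<^sup>+ g. ennreal (norm (\<chi> i. g i :: real ^ 'k)) \<partial>?M)"
    unfolding std_gaussian_def by (subst nn_integral_distr[OF vec_lambda_measurable_PiM]) auto
  also have "\<dots> \<le> (\<integral>\<^sup>+ g. (\<Sum>i\<in>UNIV. ennreal \<bar>g i\<bar>) \<partial>?M)"
  proof (rule nn_integral_mono)
    fix g :: "'k \<Rightarrow> real"
    have "norm (\<chi> i. g i :: real ^ 'k) \<le> (\<Sum>i\<in>UNIV. \<bar>g i\<bar>)"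
      using norm_le_l1_cart[of "\<chi> i. g i"] by simp
    then show "ennreal (norm (\<chi> i. g i)) \<le> (\<Sum>i\<in>UNIV. ennreal \<bar>g i\<bar>)"
      by (simp add: sum_ennreal ennreal_leI)
  qed
  also have "\<dots> = (\<Sum>i\<in>UNIV. \<integral>\<^sup>+ g. ennreal \<bar>g i\<bar> \<partial>?M)"
    by (rule nn_integral_sum) measurable
  also have "\<dots> < \<infinity>" using one by (simp add: less_top)
  finally show ?thesis .
qed

lemma gaussian_kernel_measurable:
  fixes f :: "real ^ 'n \<Rightarrow> real ^ 'n" and b :: "real ^ 'n \<Rightarrow> real ^ 'k ^ 'n"
  assumes "continuous_on UNIV f" "continuous_on UNIV b"
  shows "(\<lambda>x. gaussian (f x) (b x)) \<in> borel \<rightarrow>\<^sub>M prob_algebra borel"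
  unfolding gaussian_def
proof (rule measurable_distr_prob_space2)
  show "(\<lambda>x. std_gaussian) \<in> borel \<rightarrow>\<^sub>M prob_algebra borel"
    by (simp add: std_gaussian_prob)
  have "continuous_on UNIV (\<lambda>z. f (fst z) + b (fst z) *v snd z)"
    by (intro continuous_intros continuous_on_compose2[OF assms(1)] continuous_on_compose2[OF assms(2)]) auto
  then show "(\<lambda>(x, w). f x + b x *v w) \<in> borel_measurable (borel \<Otimes>\<^sub>M borel)"
    unfolding borel_prod case_prod_beta by (rule borel_measurable_continuous_onI)
qed

text \<open>Couple the noise \<open>w\<close> with the perturbation that corrects \<open>f x + b x w\<close> to
  \<open>m + B w\<close> pathwise. Only the mean size of the correction has to be paid for.\<close>

lemma gaussian_in_L1_laws:
  fixes B :: "real ^ 'k ^ 'n"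
  assumes "0 < \<theta>"
    and "(\<integral>\<^sup>+ w. ennreal (infnorm (m - f x + (B - b x) *v w)) \<partial>std_gaussian) \<le> ennreal \<theta>"
  shows "gaussian m B \<in> L1_laws f b \<theta> x"
proof -
  \<comment> \<open>The perturbation is a function of the noise, so that the joint law sits on a graph.\<close>
  define g where "g w = (1 / \<theta>) *\<^sub>R (m - f x + (B - b x) *v w)" for w
  define M where "M = distr std_gaussian borel (\<lambda>w. (w, g w))"
  have "continuous_on UNIV (\<lambda>w. (w, g w))"
    unfolding g_def by (intro continuous_intros)
  then have pair [measurable]: "(\<lambda>w. (w, g w)) \<in> borel_measurable std_gaussian"
    by (simp add: borel_measurable_continuous_onI cong: measurable_cong_sets)
  have [measurable]: "(infnorm :: real ^ 'n \<Rightarrow> real) \<in> borel_measurable borel"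
    by (intro borel_measurable_continuous_onI)
       (simp add: continuous_on_def tendsto_infnorm)
  have "continuous_on UNIV (\<lambda>w. m - f x + (B - b x) *v w)" by (intro continuous_intros)
  then have [measurable]: "(\<lambda>w. m - f x + (B - b x) *v w) \<in> borel_measurable borel"
    by (rule borel_measurable_continuous_onI)
  have fst [measurable]: "(fst :: (real ^ 'k) \<times> (real ^ 'n) \<Rightarrow> _) \<in> borel_measurable borel"
    and snd [measurable]: "(snd :: (real ^ 'k) \<times> (real ^ 'n) \<Rightarrow> _) \<in> borel_measurable borel"
    by (intro borel_measurable_continuous_onI continuous_intros)+
  have "M \<in> space (prob_algebra borel)"
    using std_gaussian_prob prob_space.prob_space_distr[OF _ pair]
    by (simp add: M_def space_prob_algebra)
  moreover have "distr M borel fst = std_gaussian"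
    unfolding M_def by (subst distr_distr) (auto simp: comp_def distr_id2)
  moreover have "(\<integral>\<^sup>+ z. ennreal (infnorm (snd z)) \<partial>M) \<le> 1"
  proof -
    have "(\<integral>\<^sup>+ z. ennreal (infnorm (snd z)) \<partial>M) = (\<integral>\<^sup>+ w. ennreal (infnorm (g w)) \<partial>std_gaussian)"
      unfolding M_def by (subst nn_integral_distr) auto
    also have "\<dots> = (\<integral>\<^sup>+ w. ennreal (1 / \<theta>) * ennreal (infnorm (m - f x + (B - b x) *v w)) \<partial>std_gaussian)"
      using \<open>0 < \<theta>\<close> by (simp add: g_def infnorm_mul ennreal_mult' del: times_divide_eq_left)
    also have "\<dots> = ennreal (1 / \<theta>) * (\<integral>\<^sup>+ w. ennreal (infnorm (m - f x + (B - b x) *v w)) \<partial>std_gaussian)"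
      by (rule nn_integral_cmult) measurable
    also have "\<dots> \<le> ennreal (1 / \<theta>) * ennreal \<theta>" using assms(2) by (rule mult_left_mono) simp
    also have "\<dots> = 1" using \<open>0 < \<theta>\<close> by (simp flip: ennreal_mult)
    finally show ?thesis .
  qed
  moreover have "distr M borel (\<lambda>(w, \<xi>). f x + b x *v w + \<theta> *\<^sub>R \<xi>) = gaussian m B"
  proof -
    have "continuous_on UNIV (\<lambda>z :: (real ^ 'k) \<times> (real ^ 'n). f x + b x *v fst z + \<theta> *\<^sub>R snd z)"
      by (intro continuous_intros)
    then have "(\<lambda>(w, \<xi>). f x + b x *v w + \<theta> *\<^sub>R \<xi>) \<in> borel_measurable borel"
      by (simp add: borel_measurable_continuous_onI case_prod_beta)
    then have "distr M borel (\<lambda>(w, \<xi>). f x + b x *v w + \<theta> *\<^sub>R \<xi>)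
        = distr std_gaussian borel (\<lambda>w. f x + b x *v w + \<theta> *\<^sub>R g w)"
      unfolding M_def by (subst distr_distr) (auto simp: comp_def)
    also have "(\<lambda>w. f x + b x *v w + \<theta> *\<^sub>R g w) = (\<lambda>w. m + B *v w)"
      using \<open>0 < \<theta>\<close> by (auto simp: g_def matrix_vector_mult_diff_rdistrib)
    finally show ?thesis by (simp add: gaussian_def)
  qed
  ultimately show ?thesis unfolding L1_laws_def by (intro CollectI exI[of _ M]) auto
qed

text \<open>The correction from \<open>x\<close> to \<open>y\<close> consists of the point mass (at most \<open>\<theta>\<^sub>1\<close>), the change of drift
  (at most \<open>\<eta>\<close>) and the change of diffusion applied to \<open>w\<close> (in the mean at most \<open>\<eta> C\<close>).\<close>

lemma point_mass_laws_subset_L1_laws: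
  fixes f :: "real ^ 'n \<Rightarrow> real ^ 'n" and b :: "real ^ 'n \<Rightarrow> real ^ 'k ^ 'n"
  assumes C: "(\<integral>\<^sup>+ w. ennreal (norm w) \<partial>(std_gaussian :: (real ^ 'k) measure)) = ennreal C" "0 \<le> C"
    and "norm (f y - f x) \<le> \<eta>" "norm (b y - b x) \<le> \<eta>"
    and "0 \<le> \<theta>\<^sub>1" "0 < \<theta>\<^sub>2" "\<theta>\<^sub>1 + \<eta> * (1 + C) \<le> \<theta>\<^sub>2"
  shows "point_mass_laws f b \<theta>\<^sub>1 y \<subseteq> L1_laws f b \<theta>\<^sub>2 x"
proof
  fix \<mu> assume "\<mu> \<in> point_mass_laws f b \<theta>\<^sub>1 y"
  then obtain \<xi> where \<xi>: "infnorm \<xi> \<le> 1" "\<mu> = gaussian (f y + \<theta>\<^sub>1 *\<^sub>R \<xi>) (b y)"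
    by (auto simp: point_mass_laws_def)
  have "0 \<le> \<eta>" using assms(3) norm_ge_zero order_trans by blast
  interpret prob_space "std_gaussian :: (real ^ 'k) measure"
    using std_gaussian_prob by (simp add: space_prob_algebra)
  let ?D = "\<lambda>w. f y + \<theta>\<^sub>1 *\<^sub>R \<xi> - f x + (b y - b x) *v w"
  have bound: "infnorm (?D w) \<le> (\<theta>\<^sub>1 + \<eta>) + \<eta> * norm w" for w
  proof -
    have "?D w = ((f y - f x) + \<theta>\<^sub>1 *\<^sub>R \<xi>) + (b y - b x) *v w" by simp
    then have "infnorm (?D w) \<le> infnorm ((f y - f x) + \<theta>\<^sub>1 *\<^sub>R \<xi>) + infnorm ((b y - b x) *v w)"
      by (simp only: infnorm_triangle)
    also have "\<dots> \<le> infnorm (f y - f x) + infnorm (\<theta>\<^sub>1 *\<^sub>R \<xi>) + infnorm ((b y - b x) *v w)"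
      by (intro add_right_mono infnorm_triangle)
    finally have "infnorm (?D w) \<le> infnorm (f y - f x) + infnorm (\<theta>\<^sub>1 *\<^sub>R \<xi>) + infnorm ((b y - b x) *v w)" .
    moreover have "infnorm (f y - f x) \<le> \<eta>"
      using infnorm_le_norm assms(3) order_trans by blast
    moreover have "infnorm (\<theta>\<^sub>1 *\<^sub>R \<xi>) \<le> \<theta>\<^sub>1"
      using \<xi>(1) \<open>0 \<le> \<theta>\<^sub>1\<close> by (simp add: infnorm_mul mult_left_le)
    moreover have "infnorm ((b y - b x) *v w) \<le> \<eta> * norm w"
      by (rule order_trans[OF infnorm_matrix_vector_mult_le mult_right_mono]) (use assms(4) in auto)
    ultimately show ?thesis by linarith
  qed
  have "(\<integral>\<^sup>+ w. ennreal (infnorm (?D w)) \<partial>std_gaussian)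
      \<le> (\<integral>\<^sup>+ w. ennreal (\<theta>\<^sub>1 + \<eta>) + ennreal \<eta> * ennreal (norm w) \<partial>(std_gaussian :: (real ^ 'k) measure))"
  proof (rule nn_integral_mono)
    fix w :: "real ^ 'k"
    have "ennreal (infnorm (?D w)) \<le> ennreal ((\<theta>\<^sub>1 + \<eta>) + \<eta> * norm w)" using bound by (rule ennreal_leI)
    also have "\<dots> = ennreal (\<theta>\<^sub>1 + \<eta>) + ennreal \<eta> * ennreal (norm w)"
      using \<open>0 \<le> \<theta>\<^sub>1\<close> \<open>0 \<le> \<eta>\<close> by (subst ennreal_plus) (auto simp: ennreal_mult)
    finally show "ennreal (infnorm (?D w)) \<le> ennreal (\<theta>\<^sub>1 + \<eta>) + ennreal \<eta> * ennreal (norm w)" .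
  qed
  also have "\<dots> = ennreal (\<theta>\<^sub>1 + \<eta>) + ennreal \<eta> * ennreal C"
    by (subst nn_integral_add) (auto simp: nn_integral_cmult C(1) emeasure_space_1[simplified])
  also have "\<dots> = ennreal (\<theta>\<^sub>1 + \<eta> * (1 + C))"
    using \<open>0 \<le> \<theta>\<^sub>1\<close> \<open>0 \<le> \<eta>\<close> \<open>0 \<le> C\<close>
    by (simp add: algebra_simps flip: ennreal_mult ennreal_plus)
  also have "\<dots> \<le> ennreal \<theta>\<^sub>2" using assms(7) by (rule ennreal_leI)
  finally show "\<mu> \<in> L1_laws f b \<theta>\<^sub>2 x"
    unfolding \<xi>(2) using \<open>0 < \<theta>\<^sub>2\<close> by (intro gaussian_in_L1_laws)
qed


section \<open>Kernels and their modifications\<close>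

text \<open>An abstraction asks for a whole kernel although only its value at \<open>x\<close> matters. Changing the
  unperturbed Gaussian kernel at the single point \<open>x\<close> does not affect measurability.\<close>

lemma transition_through_L1_law:
  fixes f :: "real ^ 'n \<Rightarrow> real ^ 'n" and b :: "real ^ 'n \<Rightarrow> real ^ 'k ^ 'n"
  assumes cont: "continuous_on UNIV f" "continuous_on UNIV b"
    and W: "W \<in> sets borel" and "0 < \<theta>" and "\<mu> \<in> L1_laws f b \<theta> x"
  obtains T where "T \<in> transition_collection W (L1_laws f b \<theta>)" "x \<in> W \<Longrightarrow> T x = \<mu>"
proof -
  \<comment> \<open>Off \<open>W\<close> the state stays put, which gives no mass to \<open>W\<close>.\<close>
  define T where "T y = (if y \<in> W then if y = x then \<mu> else gaussian (f y) (b y) else return borel y)" for y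
  have \<mu>: "\<mu> \<in> space (prob_algebra borel)"
  proof -
    obtain M :: "((real ^ 'k) \<times> (real ^ 'n)) measure" where M: "M \<in> space (prob_algebra borel)"
      "\<mu> = distr M borel (\<lambda>(w, \<xi>). f x + b x *v w + \<theta> *\<^sub>R \<xi>)"
      using assms(5) by (auto simp: L1_laws_def)
    have "continuous_on UNIV (\<lambda>z :: (real ^ 'k) \<times> (real ^ 'n). f x + b x *v fst z + \<theta> *\<^sub>R snd z)"
      by (intro continuous_intros)
    then have "(\<lambda>(w, \<xi>). f x + b x *v w + \<theta> *\<^sub>R \<xi>) \<in> borel_measurable M"
      using M(1) by (simp add: borel_measurable_continuous_onI case_prod_beta space_prob_algebra
          cong: measurable_cong_sets)
    then show ?thesis
      using M prob_space.prob_space_distr by (auto simp: space_prob_algebra)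
  qed
  have "T \<in> borel \<rightarrow>\<^sub>M prob_algebra borel"
    unfolding T_def
    using W \<mu> by (intro measurable_If_set gaussian_kernel_measurable[OF cont] measurable_If
        measurable_return_prob_space) (auto)
  moreover have "T y \<in> L1_laws f b \<theta> y" if "y \<in> W" for y
  proof -
    have "gaussian (f y) (b y) \<in> L1_laws f b \<theta> y"
      using \<open>0 < \<theta>\<close> by (intro gaussian_in_L1_laws) (auto simp: infnorm_0)
    then show ?thesis using that assms(5) by (simp add: T_def)
  qed
  moreover have "measure (T y) W = 0" if "y \<notin> W" for y
    using that W by (simp add: T_def measure_return)
  ultimately have "T \<in> transition_collection W (L1_laws f b \<theta>)"
    by (simp add: transition_collection_def)
  then show ?thesis by (rule that) (simp add: T_def)
qed

lemma modified_transition_prob: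
  assumes "modified_transition W T T'"
  shows "T' x \<in> space (prob_algebra borel)"
  using assms measurable_space[of T' borel "prob_algebra borel" x] by (simp add: modified_transition_def)

lemma measure_eq_on_complement_if_eq_inside:
  assumes \<mu>: "\<mu> \<in> space (prob_algebra borel)" and \<nu>: "\<nu> \<in> space (prob_algebra borel)"
    and "W \<in> sets borel" and inside: "\<And>A. A \<in> sets borel \<Longrightarrow> A \<subseteq> W \<Longrightarrow> measure \<mu> A = measure \<nu> A"
    and "A \<in> sets borel" and "A \<subseteq> W \<or> A = - W"
  shows "measure \<mu> A = measure \<nu> A"
proof -
  have "measure \<kappa> (- W) = 1 - measure \<kappa> W" if "\<kappa> \<in> space (prob_algebra borel)" for \<kappa>
  proof -
    have "sets \<kappa> = sets borel" "prob_space \<kappa>" using that by (auto simp: space_prob_algebra)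
    then show ?thesis
      using prob_space.prob_compl[of \<kappa> W] \<open>W \<in> sets borel\<close> sets_eq_imp_space_eq[of \<kappa> borel]
      by (simp add: Compl_eq_Diff_UNIV)
  qed
  then show ?thesis using assms by auto
qed

text \<open>A modification fixes the masses inside \<open>W\<close>, and hence that of \<open>- W\<close>, whatever choice was made
  for the placement on the boundary.\<close>

lemma modified_transition_measure_cong:
  fixes W A :: "(real ^ 'n) set"
  assumes "modified_transition W T T'" "modified_transition W S S'"
    and "W \<in> sets borel" and eq: "x \<in> W \<Longrightarrow> T x = S y" and xy: "x \<in> W \<longleftrightarrow> y \<in> W"
    and "A \<in> sets borel" "A \<subseteq> W \<or> A = - W"
  shows "measure (T' x) A = measure (S' y) A"
proof (rule measure_eq_on_complement_if_eq_inside)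
  show p: "T' x \<in> space (prob_algebra borel)" "S' y \<in> space (prob_algebra borel)"
    using assms by (auto intro: modified_transition_prob)
  fix A :: "(real ^ 'n) set" assume A: "A \<in> sets borel" "A \<subseteq> W"
  show "measure (T' x) A = measure (S' y) A"
  proof (cases "x \<in> W")
    case True
    then show ?thesis using assms A by (auto simp: modified_transition_def)
  next
    case False
    then have "measure (T' x) W = 0" "measure (S' y) W = 0"
      using assms by (auto simp: modified_transition_def)
    moreover have "measure \<kappa> A \<le> measure \<kappa> W" if "\<kappa> \<in> space (prob_algebra borel)" for \<kappa> :: "(real ^ 'n) measure"
      using that A \<open>W \<in> sets borel\<close>
      by (auto simp: space_prob_algebra intro!: finite_measure.finite_measure_mono prob_space.finite_measure)
    ultimately show ?thesis using p by (metis measure_le_0_iff)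
  qed
qed (use assms in auto)


section \<open>The finite abstraction\<close>

definition cell_agreement :: "'s::topological_space set set \<Rightarrow> ('s measure \<times> 's set measure) set" where
  "cell_agreement Q = {(\<mu>, \<nu>). \<mu> \<in> space (prob_algebra borel) \<and>
     \<nu> \<in> space (prob_algebra (count_space Q)) \<and> (\<forall>r\<in>Q. measure \<mu> r = measure \<nu> {r})}"

lemma cell_relation_converse_Image: "q \<in> Q \<Longrightarrow> (cell_relation Q)\<inverse> `` {q} = q"
  by (auto simp: cell_relation_def)

lemma row_measure_in_cell_agreement:
  assumes "finite Q" and "stochastic_matrix Q \<Theta>" and "q \<in> Q"
    and "\<mu> \<in> space (prob_algebra borel)" and "\<And>r. r \<in> Q \<Longrightarrow> measure \<mu> r = \<Theta> q r"
  shows "(\<mu>, row_measure Q \<Theta> q) \<in> cell_agreement Q"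
proof -
  have \<Theta>: "\<And>r. r \<in> Q \<Longrightarrow> 0 \<le> \<Theta> q r" "(\<Sum>r\<in>Q. \<Theta> q r) = 1"
    using assms by (auto simp: stochastic_matrix_def)
  have *: "emeasure (row_measure Q \<Theta> q) A = (\<Sum>r\<in>A. ennreal (\<Theta> q r))" if "A \<subseteq> Q" for A
    unfolding row_measure_def using that \<open>finite Q\<close> by (rule emeasure_point_measure_finite[rotated])
  have "emeasure (row_measure Q \<Theta> q) Q = 1"
    using \<Theta> by (simp add: * sum_ennreal)
  then have "prob_space (row_measure Q \<Theta> q)"
    by (intro prob_spaceI) (simp add: row_measure_def space_point_measure)
  moreover have "sets (row_measure Q \<Theta> q) = Pow Q"
    by (simp add: row_measure_def sets_point_measure)
  moreover have "measure (row_measure Q \<Theta> q) {r} = \<Theta> q r" if "r \<in> Q" for r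
    using that \<Theta>(1) by (simp add: measure_def *)
  ultimately show ?thesis using assms by (simp add: cell_agreement_def space_prob_algebra)
qed

lemma sum_measure_cells:
  assumes "finite Q" and "partition_on UNIV Q" and "Q \<subseteq> sets borel"
    and \<mu>: "\<mu> \<in> space (prob_algebra borel)"
  shows "(\<Sum>r\<in>Q. measure \<mu> r) = 1"
proof -
  interpret prob_space \<mu> using \<mu> by (simp add: space_prob_algebra)
  have sets: "sets \<mu> = sets borel" using \<mu> by (simp add: space_prob_algebra)
  have "(\<Sum>r\<in>Q. measure \<mu> r) = measure \<mu> (\<Union>r\<in>Q. r)"
    using assms sets
    by (intro finite_measure_finite_Union[symmetric])
       (auto simp: partition_on_def disjoint_def disjoint_family_on_def)
  also have "(\<Union>r\<in>Q. r) = space \<mu>"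
    using assms(2) sets_eq_imp_space_eq[OF sets] by (simp add: partition_on_def)
  finally show ?thesis by (simp add: prob_space)
qed

lemma cells_partition_on:
  assumes "partition_on W P" and "W \<noteq> UNIV"
  shows "partition_on UNIV (cells W P)"
proof -
  have "disjnt (- W) (\<Union> P)" "- W \<noteq> {}" using assms by (auto simp: partition_on_def disjnt_def)
  then show ?thesis
    unfolding cells_def using assms(1) by (subst partition_on_insert) (auto simp: Compl_eq_Diff_UNIV double_diff)
qed

text \<open>The finite system is the smallest one that abstracts \<open>X\<^sub>1\<close> with rows free to combine. Each of its
  rows comes from some state of the cell, whereas \<open>X\<^sub>2\<close> has to reproduce it from every state of the
  cell; the domination hypothesis bridges this difference.\<close>

theorem finite_abstraction_of_cellwise_dominated:
  fixes W :: "'s::topological_space set" and X\<^sub>1 X\<^sub>2 :: "('s, 'p) markov_system"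
  assumes Q: "finite Q" "partition_on UNIV Q" "Q \<subseteq> sets borel"
    and label: "label X\<^sub>2 = label X\<^sub>1" "\<And>q. q \<in> Q \<Longrightarrow> label X\<^sub>1 constant_on q"
      "\<And>x. label X\<^sub>1 x \<subseteq> AP" "finite AP"
    and prob: "\<And>T x. T \<in> transitions X\<^sub>1 \<Longrightarrow> T x \<in> space (prob_algebra borel)"
      "\<And>T x. T \<in> transitions X\<^sub>2 \<Longrightarrow> T x \<in> space (prob_algebra borel)"
    and dom: "\<And>q x y T. q \<in> Q \<Longrightarrow> x \<in> q \<Longrightarrow> y \<in> q \<Longrightarrow> T \<in> transitions X\<^sub>1 \<Longrightarrow>
      \<exists>S\<in>transitions X\<^sub>2. \<forall>r\<in>Q. measure (S x) r = measure (T y) r"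
    and "(x\<^sub>0, q\<^sub>0) \<in> cell_relation Q"
  obtains \<Theta>\<Theta> L\<^sub>I I where "I = \<lparr>states = Q, matrices = \<Theta>\<Theta>, f_initial = q\<^sub>0, f_props = AP, f_label = L\<^sub>I\<rparr>"
    and "finite_markov_system I"
    and "finite_abstracts (cell_relation Q) (cell_agreement Q) X\<^sub>1 I"
    and "continuous_abstracts (cell_relation Q) ((cell_agreement Q)\<inverse>) I X\<^sub>2"
proof -
  define rep where "rep q = (SOME x. x \<in> q)" for q :: "'s set"
  have rep: "rep q \<in> q" if "q \<in> Q" for q
    using that Q(2) unfolding rep_def by (metis partition_on_def some_in_eq)
  define L\<^sub>I where "L\<^sub>I q = label X\<^sub>1 (rep q)" for q
  define \<Theta>\<Theta> where "\<Theta>\<Theta> = {\<Theta>. \<forall>q\<in>Q. \<exists>T\<in>transitions X\<^sub>1. \<exists>x\<in>q. \<forall>r\<in>Q. \<Theta> q r = measure (T x) r}"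
  define I where "I = \<lparr>states = Q, matrices = \<Theta>\<Theta>, f_initial = q\<^sub>0, f_props = AP, f_label = L\<^sub>I\<rparr>"
  have stoch: "stochastic_matrix Q \<Theta>" if "\<Theta> \<in> \<Theta>\<Theta>" for \<Theta>
    unfolding stochastic_matrix_def
  proof
    fix q assume "q \<in> Q"
    then obtain T x where "T \<in> transitions X\<^sub>1" "\<And>r. r \<in> Q \<Longrightarrow> \<Theta> q r = measure (T x) r"
      using \<open>\<Theta> \<in> \<Theta>\<Theta>\<close> by (auto simp: \<Theta>\<Theta>_def)
    then show "(\<forall>r\<in>Q. 0 \<le> \<Theta> q r) \<and> (\<Sum>r\<in>Q. \<Theta> q r) = 1"
      using sum_measure_cells[OF Q] prob by simp
  qed
  have "finite_markov_system I"
    using Q(1) stoch label \<open>(x\<^sub>0, q\<^sub>0) \<in> _\<close>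
    by (auto simp: finite_markov_system_def I_def L\<^sub>I_def cell_relation_def)
  have state: "state_level_abstraction (cell_relation Q) X I" if "label X = label X\<^sub>1" for X
    unfolding state_level_abstraction_def
  proof (intro conjI allI)
    show "cell_relation Q \<subseteq> UNIV \<times> states I" by (auto simp: cell_relation_def I_def)
    show "\<exists>q. (x, q) \<in> cell_relation Q" for x
      using Q(2) by (auto simp: cell_relation_def partition_on_def)
    show "\<forall>(x, q)\<in>cell_relation Q. f_label I q = label X x"
      using label(2) rep that unfolding constant_on_def
      by (fastforce simp: cell_relation_def I_def L\<^sub>I_def)
  qed
  have \<gamma>: "cell_agreement Q \<subseteq> space (prob_algebra borel) \<times> space (prob_algebra (count_space Q))"
    by (auto simp: cell_agreement_def)
  have "finite_abstracts (cell_relation Q) (cell_agreement Q) X\<^sub>1 I"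
    unfolding finite_abstracts_def measure_level_abstraction_to_def
  proof (intro conjI ballI state)
    show "cell_agreement Q \<subseteq> space (prob_algebra borel) \<times> space (prob_algebra (count_space (states I)))"
      using \<gamma> by (simp add: I_def)
    fix q T x assume "q \<in> states I" "T \<in> transitions X\<^sub>1" "x \<in> (cell_relation Q)\<inverse> `` {q}"
    then have q: "q \<in> Q" "x \<in> q" by (auto simp: I_def cell_relation_def)
    \<comment> \<open>Only row \<open>q\<close> is prescribed; representatives of the other cells fill the remaining rows.\<close>
    define \<Theta> where "\<Theta> q' r = measure (T (if q' = q then x else rep q')) r" for q' r
    have "\<Theta> \<in> \<Theta>\<Theta>"
      using q rep \<open>T \<in> transitions X\<^sub>1\<close> by (fastforce simp: \<Theta>\<Theta>_def \<Theta>_def)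
    moreover have "(T x, row_measure Q \<Theta> q) \<in> cell_agreement Q"
      using stoch[OF \<open>\<Theta> \<in> \<Theta>\<Theta>\<close>] q prob(1) \<open>T \<in> transitions X\<^sub>1\<close>
      by (intro row_measure_in_cell_agreement Q) (auto simp: \<Theta>_def)
    ultimately show "\<exists>\<Theta>\<in>matrices I. (T x, row_measure (states I) \<Theta> q) \<in> cell_agreement Q \<and>
        (\<forall>r\<in>states I. measure (T x) ((cell_relation Q)\<inverse> `` {r}) = \<Theta> q r)"
      by (intro bexI[of _ \<Theta>]) (auto simp: I_def \<Theta>_def cell_relation_converse_Image)
  qed simp
  moreover have "continuous_abstracts (cell_relation Q) ((cell_agreement Q)\<inverse>) I X\<^sub>2"
    unfolding continuous_abstracts_def measure_level_abstraction_from_def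
  proof (intro conjI ballI state)
    show "(cell_agreement Q)\<inverse> \<subseteq> space (prob_algebra (count_space (states I))) \<times> space (prob_algebra borel)"
      using \<gamma> by (auto simp: I_def)
    fix q \<Theta> x assume "q \<in> states I" "\<Theta> \<in> matrices I" "x \<in> (cell_relation Q)\<inverse> `` {q}"
    then have q: "q \<in> Q" "x \<in> q" "\<Theta> \<in> \<Theta>\<Theta>" by (auto simp: I_def cell_relation_def)
    then obtain T y where T: "T \<in> transitions X\<^sub>1" "y \<in> q" "\<And>r. r \<in> Q \<Longrightarrow> \<Theta> q r = measure (T y) r"
      by (fastforce simp: \<Theta>\<Theta>_def)
    obtain S where S: "S \<in> transitions X\<^sub>2" "\<And>r. r \<in> Q \<Longrightarrow> measure (S x) r = measure (T y) r"
      using dom[OF q(1,2) T(2,1)] by blast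
    have "(S x, row_measure Q \<Theta> q) \<in> cell_agreement Q"
      using stoch q prob(2) S T by (intro row_measure_in_cell_agreement Q) auto
    then show "\<exists>S\<in>transitions X\<^sub>2. (row_measure (states I) \<Theta> q, S x) \<in> (cell_agreement Q)\<inverse> \<and>
        (\<forall>r\<in>states I. measure (S x) ((cell_relation Q)\<inverse> `` {r}) = \<Theta> q r)"
      using S T(3) by (intro bexI[of _ S]) (auto simp: I_def cell_relation_converse_Image)
  qed (use label in simp)
  ultimately show ?thesis using that \<open>finite_markov_system I\<close> I_def by blast
qed

theorem theorem4:
  fixes f :: "real ^ 'n \<Rightarrow> real ^ 'n"
    and b :: "real ^ 'n \<Rightarrow> real ^ 'k ^ 'n"
    and W :: "(real ^ 'n) set"
    and \<theta>\<^sub>1 \<theta>\<^sub>2 :: real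
    and x\<^sub>0 :: "real ^ 'n"
    and AP :: "'p set" and inn :: 'p
    and L :: "real ^ 'n \<Rightarrow> 'p set"
    and TT\<^sub>1 TT\<^sub>2 :: "(real ^ 'n \<Rightarrow> (real ^ 'n) measure) set"
    and X\<^sub>1 X\<^sub>2 :: "(real ^ 'n, 'p) markov_system"
  assumes "bounded W"
    and "locally_lipschitz f" and "locally_lipschitz b"
    and "0 \<le> \<theta>\<^sub>1" and "\<theta>\<^sub>1 < \<theta>\<^sub>2"
    and "labelling W AP inn L"
    and "amenable_to_rectangular_partition W L"
    and "modified_collection W (transition_collection W (point_mass_laws f b \<theta>\<^sub>1)) TT\<^sub>1"
    and "modified_collection W (transition_collection W (L1_laws f b \<theta>\<^sub>2)) TT\<^sub>2"
    and "X\<^sub>1 = \<lparr>transitions = TT\<^sub>1, initial = x\<^sub>0, props = AP, label = L\<rparr>"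
    and "X\<^sub>2 = \<lparr>transitions = TT\<^sub>2, initial = x\<^sub>0, props = AP, label = L\<rparr>"
  shows "\<exists>P Q \<alpha> \<gamma> \<Theta>\<Theta> q\<^sub>0 L\<^sub>I (I :: ((real ^ 'n) set, 'p) finite_system).
           rectangular_partition W P \<and> Q = cells W P \<and> \<alpha> = cell_relation Q \<and>
           (x\<^sub>0, q\<^sub>0) \<in> \<alpha> \<and>
           I = \<lparr>states = Q, matrices = \<Theta>\<Theta>, f_initial = q\<^sub>0, f_props = AP, f_label = L\<^sub>I\<rparr> \<and>
           finite_markov_system I \<and>
           finite_abstracts \<alpha> \<gamma> X\<^sub>1 I \<and>
           continuous_abstracts \<alpha> (\<gamma>\<inverse>) I X\<^sub>2"
proof -
  obtain P\<^sub>0 where P\<^sub>0: "rectangular_partition W P\<^sub>0" "\<And>R. R \<in> insert (- W) P\<^sub>0 \<Longrightarrow> L constant_on R"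
    using assms(7) by (auto simp: amenable_to_rectangular_partition_def)
  have W: "W \<in> sets borel" using P\<^sub>0(1) by (rule rectangular_partition_borel)
  have cont: "continuous_on UNIV f" "continuous_on UNIV b"
    using assms(2,3) by (simp_all add: locally_lipschitz_continuous_on)
  define C where "C = enn2real (\<integral>\<^sup>+ w. ennreal (norm w) \<partial>(std_gaussian :: (real ^ 'k) measure))"
  have C: "(\<integral>\<^sup>+ w. ennreal (norm w) \<partial>(std_gaussian :: (real ^ 'k) measure)) = ennreal C" "0 \<le> C"
    using nn_integral_norm_std_gaussian[where 'k='k] by (auto simp: C_def)
  \<comment> \<open>The largest variation over a cell that the slack in the intensities can absorb.\<close>
  define \<eta> where "\<eta> = (\<theta>\<^sub>2 - \<theta>\<^sub>1) / (1 + C)"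
  have \<eta>: "0 < \<eta>" "\<theta>\<^sub>1 + \<eta> * (1 + C) \<le> \<theta>\<^sub>2"
    using assms(5) C(2) by (auto simp: \<eta>_def)
  have unif: "\<exists>d>0. \<forall>x\<in>W. \<forall>y\<in>W. dist y x < d \<longrightarrow> dist (g y) (g x) < \<eta>"
    if "continuous_on UNIV g" for g :: "real ^ 'n \<Rightarrow> 'z::metric_space"
  proof -
    have "uniformly_continuous_on (closure W) g"
      using \<open>bounded W\<close> that by (intro compact_uniformly_continuous) (auto intro: continuous_on_subset)
    then obtain d where "0 < d" "\<forall>x\<in>closure W. \<forall>y\<in>closure W. dist y x < d \<longrightarrow> dist (g y) (g x) < \<eta>"
      using \<eta>(1) unfolding uniformly_continuous_on_def by blast
    then show ?thesis using closure_subset by blast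
  qed
  obtain d\<^sub>f where d\<^sub>f: "0 < d\<^sub>f" "\<forall>x\<in>W. \<forall>y\<in>W. dist y x < d\<^sub>f \<longrightarrow> dist (f y) (f x) < \<eta>"
    using unif[OF cont(1)] by blast
  obtain d\<^sub>b where d\<^sub>b: "0 < d\<^sub>b" "\<forall>x\<in>W. \<forall>y\<in>W. dist y x < d\<^sub>b \<longrightarrow> dist (b y) (b x) < \<eta>"
    using unif[OF cont(2)] by blast
  obtain P where P: "rectangular_partition W P"
    and refines: "\<And>R. R \<in> P \<Longrightarrow> \<exists>R\<^sub>0\<in>P\<^sub>0. R \<subseteq> R\<^sub>0"
    and mesh: "\<And>R x y. R \<in> P \<Longrightarrow> x \<in> R \<Longrightarrow> y \<in> R \<Longrightarrow> dist x y < min d\<^sub>f d\<^sub>b"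
    using rectangular_partition_refine[OF P\<^sub>0(1) assms(1), of "min d\<^sub>f d\<^sub>b"] d\<^sub>f d\<^sub>b by auto
  have part: "finite P" "partition_on W P" "\<And>R. R \<in> P \<Longrightarrow> R \<in> sets borel"
    using P axis_box_borel by (auto simp: rectangular_partition_def)
  define Q where "Q = cells W P"
  have "W \<noteq> UNIV" using \<open>bounded W\<close> not_bounded_UNIV by metis
  then have Q: "finite Q" "partition_on UNIV Q" "Q \<subseteq> sets borel"
    using part W cells_partition_on by (auto simp: Q_def cells_def)
  have Q_cases: "r \<subseteq> W \<or> r = - W" if "r \<in> Q" for r
    using that part(2) by (auto simp: Q_def cells_def partition_on_def)
  have TT: "rel_set (modified_transition W) (transition_collection W (point_mass_laws f b \<theta>\<^sub>1)) TT\<^sub>1"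
      "rel_set (modified_transition W) (transition_collection W (L1_laws f b \<theta>\<^sub>2)) TT\<^sub>2"
    using assms(8,9) by (simp_all add: modified_collection_def)
  have dom: "\<exists>S'\<in>TT\<^sub>2. \<forall>r\<in>Q. measure (S' x) r = measure (T' y) r"
    if q: "q \<in> Q" "x \<in> q" "y \<in> q" and "T' \<in> TT\<^sub>1" for q x y T'
  proof -
    obtain T where T: "T \<in> transition_collection W (point_mass_laws f b \<theta>\<^sub>1)" "modified_transition W T T'"
      using rel_setD2[OF TT(1) \<open>T' \<in> TT\<^sub>1\<close>] by blast
    have "0 < \<theta>\<^sub>2" using assms(4,5) by simp
    have xy: "x \<in> W \<longleftrightarrow> y \<in> W" using Q_cases[OF q(1)] q by auto
    \<comment> \<open>Off \<open>W\<close> the law is immaterial, but some kernel of the second collection is still needed.\<close>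
    have "\<exists>\<mu>\<in>L1_laws f b \<theta>\<^sub>2 x. x \<in> W \<longrightarrow> \<mu> = T y"
    proof (cases "x \<in> W")
      case True
      then have "q \<in> P" using q by (auto simp: Q_def cells_def)
      then have "dist (f y) (f x) < \<eta>" "dist (b y) (b x) < \<eta>"
        using d\<^sub>f(2) d\<^sub>b(2) mesh q True xy by (metis min_less_iff_conj)+
      then have "point_mass_laws f b \<theta>\<^sub>1 y \<subseteq> L1_laws f b \<theta>\<^sub>2 x"
        using C \<eta>(2) assms(4) \<open>0 < \<theta>\<^sub>2\<close>
        by (intro point_mass_laws_subset_L1_laws[where \<eta> = \<eta>]) (auto simp: dist_norm)
      then show ?thesis using T(1) True xy by (auto simp: transition_collection_def)
    next
      case False
      then show ?thesis
        using gaussian_in_L1_laws[of \<theta>\<^sub>2 "f x" f x "b x" b] \<open>0 < \<theta>\<^sub>2\<close> by (auto simp: infnorm_0)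
    qed
    then obtain S where S: "S \<in> transition_collection W (L1_laws f b \<theta>\<^sub>2)" "x \<in> W \<Longrightarrow> S x = T y"
      using transition_through_L1_law[OF cont W \<open>0 < \<theta>\<^sub>2\<close>] by metis
    then obtain S' where S': "S' \<in> TT\<^sub>2" "modified_transition W S S'"
      using rel_setD1[OF TT(2)] by blast
    have "measure (S' x) r = measure (T' y) r" if "r \<in> Q" for r
      using Q(3) that by (intro modified_transition_measure_cong[OF S'(2) T(2) W S(2) xy _ Q_cases]) auto
    then show ?thesis using S' by blast
  qed
  have L: "L x \<subseteq> AP" "finite AP" for x
    using assms(6) measurable_space[of L borel "count_space (Pow AP)" x] by (auto simp: labelling_def)
  have const: "L constant_on q" if "q \<in> Q" for q
    using that P\<^sub>0(2) refines by (metis Q_def cells_def constant_on_subset insert_iff)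
  have prob: "T' x \<in> space (prob_algebra borel)" if "T' \<in> TT\<^sub>1 \<union> TT\<^sub>2" for T' x
    using that TT by (auto dest: rel_setD2 intro: modified_transition_prob)
  obtain q\<^sub>0 where q\<^sub>0: "(x\<^sub>0, q\<^sub>0) \<in> cell_relation Q"
    using Q(2) by (auto simp: cell_relation_def partition_on_def)
  obtain \<Theta>\<Theta> L\<^sub>I and I :: "((real ^ 'n) set, 'p) finite_system" where
    "I = \<lparr>states = Q, matrices = \<Theta>\<Theta>, f_initial = q\<^sub>0, f_props = AP, f_label = L\<^sub>I\<rparr>"
    "finite_markov_system I"
    "finite_abstracts (cell_relation Q) (cell_agreement Q) X\<^sub>1 I"
    "continuous_abstracts (cell_relation Q) ((cell_agreement Q)\<inverse>) I X\<^sub>2"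
    by (rule finite_abstraction_of_cellwise_dominated[OF Q, of X\<^sub>2 X\<^sub>1 AP x\<^sub>0 q\<^sub>0])
       (use L const prob dom q\<^sub>0 assms(10,11) in auto)
  then show ?thesis using P q\<^sub>0 Q_def by blast
qed

end
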